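(* Let $a\in\mathbb{N}$, $c\geq 1$, and let $(k_i)_{i\in\mathbb{N}}$ be integers with $2\leq k_1\leq k_2\leq\cdots$. Define $W_0=1$ and $W_i=\mathbf{W}(k_i,c^{W_0W_1\cdots W_{i-1}})$ for $i\in\mathbb{N}$. Let $l_1,l_2,\dots$ be positive integers such that for every $i\geq 2$, $l_i>(W_1-1)l_1+\cdots+(W_{i-1}-1)l_{i-1}$. For $i\in\mathbb{N}$ let \[ A_i=\{a+x_1l_1+\cdots+x_il_i \mid 0\leq x_1\leq W_1-1,\dots,0\leq x_i\leq W_i-1\}, \] and let $A=\bigcup_{i\in\mathbb{N}}A_i$. Then for any $c$-coloring of $A$ there exist positive integers $a_i,d_i$ ($i\in\mathbb{N}$), where $d_i=\alpha_il_i$ for some integer $\alpha_i$ with $1\leq\alpha_i\leq\lfloor\frac{W_i-1}{k_i-1}\rfloor$, such that the sets \[ \{a_i+x_1d_1+\cdots+x_id_i \mid 0\leq x_1\leq k_1-1,\dots,0\leq x_i\leq k_i-1\},\quad i\in\mathbb{N}, \] are all contained in $A$ and are all monochromatic with the same color.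
   Context: $\mathbb{N}$ is the set of positive integers. A $c$-coloring is a map into $[c]=\{1,\dots,c\}$. For integers $k\geq 2$ and $c\geq 1$, $\mathbf{W}(k,c)$ denotes the van der Waerden number: the least integer $N$ such that every $c$-coloring of $\{1,\dots,N\}$ contains a monochromatic arithmetic progression of length $k$. *)

theory Defs
  imports Main "HOL-Library.FuncSet"
begin

definition monochromatic :: "(nat \<Rightarrow> nat) \<Rightarrow> nat \<Rightarrow> nat set \<Rightarrow> bool" where
  "monochromatic f q S \<longleftrightarrow> (\<forall>y\<in>S. f y = q)"

definition arith_prog :: "nat \<Rightarrow> nat \<Rightarrow> nat \<Rightarrow> nat set" where
  "arith_prog b d k = {b + j * d | j. j < k}"

text \<open>The van der Waerden number. The least element exists for all \<open>k\<close> and \<open>c\<close> by van der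
  Waerden's theorem, which is not proved here.\<close>

definition vdW :: "nat \<Rightarrow> nat \<Rightarrow> nat" where
  "vdW k c = (LEAST N. \<forall>f \<in> {1..N} \<rightarrow> {1..c}.
      \<exists>b d q. d > 0 \<and> arith_prog b d k \<subseteq> {1..N} \<and> monochromatic f q (arith_prog b d k))"

text \<open>Sequences indexed by the positive integers are functions on \<^typ>\<open>nat\<close> whose value at
  \<open>0\<close> is never used; only \<open>vdW_seq\<close> has a meaningful term at index \<open>0\<close>.\<close>

fun vdW_seq :: "(nat \<Rightarrow> nat) \<Rightarrow> nat \<Rightarrow> nat \<Rightarrow> nat" where
  "vdW_seq k c 0 = 1"
| "vdW_seq k c (Suc i) = vdW (k (Suc i)) (c ^ (\<Prod>j\<in>{0..i}. vdW_seq k c j))"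

definition gen_prog :: "nat \<Rightarrow> (nat \<Rightarrow> nat) \<Rightarrow> (nat \<Rightarrow> nat) \<Rightarrow> nat \<Rightarrow> nat set" where
  "gen_prog a d m i = {a + (\<Sum>j=1..i. x j * d j) | x. \<forall>j\<in>{1..i}. 0 \<le> x j \<and> x j \<le> m j - 1}"

end

theory Submission imports Defs begin

text \<open>For a fixed level \<open>n\<close>, colour each \<open>x < W\<^sub>n\<close> by the restriction of the colouring to
  \<open>A\<^sub>n\<^sub>-\<^sub>1 + x l\<^sub>n\<close>. As \<open>A\<^sub>n\<^sub>-\<^sub>1\<close> has at most \<open>W\<^sub>0 \<cdots> W\<^sub>n\<^sub>-\<^sub>1\<close> elements, van der Waerden's theorem gives
  an arithmetic progression of translates of \<open>A\<^sub>n\<^sub>-\<^sub>1\<close> that are all coloured alike, and one recurses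
  into the first of them. The multipliers found this way depend on \<open>n\<close>, but \<open>\<alpha>\<^sub>i\<close> and the colour
  range over finite sets, so Koenig's lemma produces a single sequence that works for all levels.
  Van der Waerden's theorem itself is obtained by colour focusing.\<close>

section \<open>Van der Waerden's theorem\<close>

text \<open>The bound \<open>b + k * d < N\<close> leaves room for one term after a progression of length \<open>k\<close>; this
  term is the focus in the induction.\<close>

definition vdW_bound :: "nat \<Rightarrow> 'a set \<Rightarrow> nat \<Rightarrow> bool" where
  "vdW_bound k S N \<longleftrightarrow> (\<forall>f. range f \<subseteq> S \<longrightarrow>
     (\<exists>b d. d > 0 \<and> b + k * d < N \<and> (\<forall>j<k. f (b + j * d) = f b)))"

text \<open>Recoding colours by an injection preserves and reflects equality of colours, so a
  progression found after recoding works before it.\<close>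

lemma vdW_bound_transfer:
  fixes S :: "'a set" and T :: "'b set"
  assumes "vdW_bound k T N" and "inj_on e S" and "e ` S \<subseteq> T"
  shows "vdW_bound k S N"
  unfolding vdW_bound_def
proof (intro allI impI)
  fix f :: "nat \<Rightarrow> 'a" assume f: "range f \<subseteq> S"
  then have "range (e \<circ> f) \<subseteq> T" using assms(3) by auto
  then obtain b d where "d > 0" "b + k * d < N" and e: "\<forall>j<k. e (f (b + j * d)) = e (f b)"
    using assms(1) unfolding vdW_bound_def comp_def by blast
  moreover have "\<forall>j<k. f (b + j * d) = f b"
    using e f assms(2) by (meson inj_onD rangeI subsetD)
  ultimately show "\<exists>b d. d > 0 \<and> b + k * d < N \<and> (\<forall>j<k. f (b + j * d) = f b)" by blast
qed

text \<open>Needed because the colours of whole blocks and of whole translates are functions, not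
  numbers; enumerating the colour set reduces to initial segments.\<close>

lemma vdW_bound_finite:
  assumes "\<And>c. \<exists>N. vdW_bound k {..<c::nat} N" and "finite S"
  shows "\<exists>N. vdW_bound k S N"
proof -
  obtain e where e: "bij_betw e S {0..<card S}"
    using ex_bij_betw_finite_nat[OF assms(2)] by blast
  obtain N where "vdW_bound k {..<card S} N" using assms(1) by blast
  then have "vdW_bound k S N"
    using e by (intro vdW_bound_transfer[of k "{..<card S}" N e])
      (auto simp: bij_betw_def atLeast0LessThan)
  then show ?thesis ..
qed

text \<open>Colour-focused progressions: \<open>z\<close> is the common next term of all
  \<open>r\<close> of them, and no condition is put on its own colour.\<close>

definition focused :: "nat \<Rightarrow> (nat \<Rightarrow> nat) \<Rightarrow> nat \<Rightarrow> nat \<Rightarrow> (nat \<Rightarrow> nat) \<Rightarrow> (nat \<Rightarrow> nat) \<Rightarrow> bool" where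
  "focused k f r z b d \<longleftrightarrow> (\<forall>i<r. d i > 0 \<and> b i + k * d i = z \<and> (\<forall>j<k. f (b i + j * d i) = f (b i)))
     \<and> inj_on (\<lambda>i. f (b i)) {..<r}"

text \<open>Induction on \<open>r\<close>. Among blocks of length \<open>N\<close>, the hypothesis
  on \<open>k\<close> gives \<open>k\<close> equally spaced blocks coloured alike. Spreading the
  \<open>r\<close> focused progressions of the first block across these blocks, and adding the
  copies of their focus, gives \<open>r + 1\<close> progressions focused one block further
  on.\<close>

lemma colour_focusing:
  assumes IH: "\<And>c. \<exists>N. vdW_bound k {..<c::nat} N"
  shows "\<exists>N. \<forall>f. range f \<subseteq> {..<c::nat} \<longrightarrow>
    (\<exists>b d. d > 0 \<and> b + k * d < N \<and> (\<forall>j\<le>k. f (b + j * d) = f b)) \<or>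
    (\<exists>z b d. z < N \<and> focused k f r z b d)"
proof (induction r)
  case 0
  show ?case by (rule exI[of _ 1]) (auto simp: focused_def)
next
  case (Suc r)
  then obtain N where N: "\<And>f. range f \<subseteq> {..<c} \<Longrightarrow>
    (\<exists>b d. d > 0 \<and> b + k * d < N \<and> (\<forall>j\<le>k. f (b + j * d) = f b)) \<or>
    (\<exists>z b d. z < N \<and> focused k f r z b d)" by blast
  define S where "S = PiE {..<N} (\<lambda>_. {..<c})"
  have "finite S" unfolding S_def by (intro finite_PiE) auto
  then obtain M where M: "vdW_bound k S M" using vdW_bound_finite[OF IH] by blast
  show ?case
  proof (intro exI[of _ "M * N"] allI impI)
    fix f :: "nat \<Rightarrow> nat" assume f: "range f \<subseteq> {..<c}"
    \<comment> \<open>The whole colouring of block number \<open>x\<close> serves as a single colour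
      from the finite set \<open>S\<close>.\<close>
    define F where "F x = restrict (\<lambda>y. f (x * N + y)) {..<N}" for x
    have "f x < c" for x using f by auto
    then have "range F \<subseteq> S" unfolding F_def S_def by (intro image_subsetI restrict_PiE_iff[THEN iffD2]) simp
    then obtain B D where D: "D > 0" "B + k * D < M" and F: "\<And>j. j < k \<Longrightarrow> F (B + j * D) = F B"
      using M unfolding vdW_bound_def by blast
    have block: "f ((B + j * D) * N + y) = f (B * N + y)" if "j < k" "y < N" for j y
      using fun_cong[OF F[OF that(1)], of y] that(2) by (simp add: F_def)
    \<comment> \<open>The new focus lies in block \<open>B + k * D\<close>, one step after the
      \<open>k\<close> equal blocks; the extra term in \<open>vdW_bound\<close> keeps it within
      range.\<close>
    have room: "(B + k * D) * N + y < M * N" if "y < N" for y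
    proof -
      have "(B + k * D) * N + y < Suc (B + k * D) * N" using that by simp
      also have "\<dots> \<le> M * N" using D(2) by (intro mult_le_mono1) simp
      finally show ?thesis .
    qed
    define g where "g y = f (B * N + y)" for y
    have "range g \<subseteq> {..<c}" using f by (auto simp: g_def)
    from N[OF this] show "(\<exists>b d. d > 0 \<and> b + k * d < M * N \<and> (\<forall>j\<le>k. f (b + j * d) = f b)) \<or>
      (\<exists>z b d. z < M * N \<and> focused k f (Suc r) z b d)"
    proof (elim disjE exE conjE)
      fix b d assume bd: "d > 0" "b + k * d < N" "\<forall>j\<le>k. g (b + j * d) = g b"
      have "(B * N + b) + k * d < M * N"
        using room[OF bd(2)] by (simp add: algebra_simps)
      then have "d > 0 \<and> (B * N + b) + k * d < M * N \<and>
          (\<forall>j\<le>k. f ((B * N + b) + j * d) = f (B * N + b))"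
        using bd by (simp add: g_def add.assoc)
      then show ?thesis by blast
    next
      fix z b d assume z: "z < N" and foc: "focused k g r z b d"
      \<comment> \<open>An old progression gains \<open>D * N\<close> in its difference, so its term
        \<open>j\<close> moves to block \<open>B + j * D\<close>. The progression with index
        \<open>r\<close> runs through the copies of \<open>z\<close>. All of them meet at
        \<open>z'\<close>.\<close>
      define z' where "z' = (B + k * D) * N + z"
      define b' where "b' i = (if i < r then B * N + b i else B * N + z)" for i
      define d' where "d' i = (if i < r then d i + D * N else D * N)" for i
      have z': "z' < M * N" using room[OF z] by (simp add: z'_def)
      have N0: "N > 0" using z by simp
      have each: "d' i > 0 \<and> b' i + k * d' i = z' \<and> (\<forall>j<k. f (b' i + j * d' i) = f (b' i))"
        if "i < Suc r" for i
      proof (cases "i < r")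
        case True
        then have i: "d i > 0" "b i + k * d i = z" "\<And>j. j < k \<Longrightarrow> g (b i + j * d i) = g (b i)"
          using foc by (auto simp: focused_def)
        have "f (b' i + j * d' i) = f (b' i)" if j: "j < k" for j
        proof -
          have "j * d i \<le> k * d i" using j by simp
          then have lt: "b i + j * d i < N" using i(2) z by linarith
          have "b' i + j * d' i = (B + j * D) * N + (b i + j * d i)"
            using True by (simp add: b'_def d'_def algebra_simps)
          then have "f (b' i + j * d' i) = g (b i + j * d i)"
            using block[OF j lt] by (simp add: g_def)
          then show ?thesis using i(3)[OF j] True by (simp add: g_def b'_def)
        qed
        moreover have "b' i + k * d' i = z'"
          using True i(2)[symmetric] by (simp add: b'_def d'_def z'_def algebra_simps)
        ultimately show ?thesis using True i(1) by (simp add: d'_def)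
      next
        case False
        have "f (b' i + j * d' i) = f (b' i)" if j: "j < k" for j
          using block[OF j z] False by (simp add: b'_def d'_def algebra_simps)
        then show ?thesis using False D(1) N0
          by (simp add: b'_def d'_def z'_def algebra_simps)
      qed
      \<comment> \<open>If \<open>z\<close> has the colour of an old progression, it extends that
        one to \<open>k + 1\<close> terms inside the first block; otherwise its colour is new and
        the colours stay distinct.\<close>
      show ?thesis
      proof (cases "\<exists>i<r. g (b i) = g z")
        case True
        then obtain i where i: "i < r" "g (b i) = g z" by blast
        then have di: "d i > 0" "b i + k * d i = z" "\<And>j. j < k \<Longrightarrow> g (b i + j * d i) = g (b i)"
          using foc by (auto simp: focused_def)
        have "g (b i + j * d i) = g (b i)" if "j \<le> k" for j
          using di i(2) that by (cases "j = k") auto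
        then have "\<forall>j\<le>k. f ((B * N + b i) + j * d i) = f (B * N + b i)"
          by (simp add: g_def add.assoc)
        moreover have "(B * N + b i) + k * d i < M * N"
          using room[OF z] di(2) by (simp add: algebra_simps)
        ultimately show ?thesis using di(1) by blast
      next
        case False
        have "inj_on (\<lambda>i. f (b' i)) {..<r}"
          using foc by (auto simp: focused_def inj_on_def b'_def g_def)
        moreover have "f (b' r) \<notin> (\<lambda>i. f (b' i)) ` {..<r}"
          using False by (auto simp: b'_def g_def)
        ultimately have "inj_on (\<lambda>i. f (b' i)) {..<Suc r}"
          by (simp add: lessThan_Suc)
        then have "focused k f (Suc r) z' b' d'" using each by (simp add: focused_def)
        then show ?thesis using z' by blast
      qed
    qed
  qed
qed

text \<open>With \<open>c\<close> colours there cannot be \<open>Suc c\<close> progressions of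
  distinct colours, so focusing with \<open>r = Suc c\<close> must yield the longer
  progression.\<close>

theorem van_der_Waerden: "\<exists>N. vdW_bound k {..<c::nat} N"
proof (induction k arbitrary: c)
  case 0
  show ?case by (rule exI[of _ 1]) (auto simp: vdW_bound_def)
next
  case (Suc k)
  obtain N where N: "\<And>f. range f \<subseteq> {..<c} \<Longrightarrow>
    (\<exists>b d. d > 0 \<and> b + k * d < N \<and> (\<forall>j\<le>k. f (b + j * d) = f b)) \<or>
    (\<exists>z b d. z < N \<and> focused k f (Suc c) z b d)"
    using colour_focusing[OF Suc, of c "Suc c"] by blast
  show ?case unfolding vdW_bound_def
  \<comment> \<open>The bound must leave room for one more term. For \<open>k > 0\<close> this
    follows from \<open>d \<le> k * d < N\<close>. For \<open>k = 0\<close> the difference is not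
    controlled by \<open>N\<close>, so \<open>b = 0\<close> and \<open>d = 1\<close> are taken, and
    the summand 2 accommodates them.\<close>
  proof (rule exI[of _ "2 * N + 2"], intro allI impI)
    fix f :: "nat \<Rightarrow> nat" assume f: "range f \<subseteq> {..<c}"
    have "\<not> focused k f (Suc c) z b d" for z b d
    proof
      assume "focused k f (Suc c) z b d"
      then have "inj_on (\<lambda>i. f (b i)) {..<Suc c}" by (simp add: focused_def)
      moreover have "(\<lambda>i. f (b i)) ` {..<Suc c} \<subseteq> {..<c}" using f by auto
      ultimately have "card {..<Suc c} \<le> card {..<c}" by (intro card_inj_on_le) auto
      then show False by simp
    qed
    then obtain b d where bd: "d > 0" "b + k * d < N" "\<forall>j\<le>k. f (b + j * d) = f b"
      using N[OF f] by blast
    show "\<exists>b d. d > 0 \<and> b + Suc k * d < 2 * N + 2 \<and> (\<forall>j<Suc k. f (b + j * d) = f b)"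
    proof (cases "k = 0")
      case True
      then have "(1::nat) > 0 \<and> 0 + Suc k * 1 < 2 * N + 2 \<and> (\<forall>j<Suc k. f (0 + j * 1) = f 0)"
        by simp
      then show ?thesis by blast
    next
      case False
      then have "1 * d \<le> k * d" by (intro mult_le_mono1) simp
      then have "b + Suc k * d < 2 * N + 2" using bd(2) unfolding mult_Suc by linarith
      then show ?thesis using bd by (auto simp: less_Suc_eq_le)
    qed
  qed
qed

section \<open>The van der Waerden number as an attained minimum\<close>

lemma vdW_property:
  assumes "c \<ge> 1" and "f \<in> {1..vdW k c} \<rightarrow> {1..c}"
  shows "\<exists>b d q. d > 0 \<and> arith_prog b d k \<subseteq> {1..vdW k c} \<and> monochromatic f q (arith_prog b d k)"
proof -
  define Q where "Q N \<longleftrightarrow> (\<forall>f \<in> {1..N} \<rightarrow> {1..c}.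
      \<exists>b d q. d > 0 \<and> arith_prog b d k \<subseteq> {1..N} \<and> monochromatic f q (arith_prog b d k))" for N
  obtain N where N: "vdW_bound k {1..c} N"
    using vdW_bound_finite[OF van_der_Waerden, of "{1..c}"] by blast
  have "Q N" unfolding Q_def
  proof
    fix f :: "nat \<Rightarrow> nat" assume f: "f \<in> {1..N} \<rightarrow> {1..c}"
    \<comment> \<open>Shifts the interval to start at 0; the default colour 1 beyond it is
      legitimate because \<open>c \<ge> 1\<close>.\<close>
    define g where "g x = (if x < N then f (Suc x) else 1)" for x
    have "range g \<subseteq> {1..c}" using f assms(1) by (force simp: g_def)
    then obtain b d where bd: "d > 0" "b + k * d < N" "\<And>j. j < k \<Longrightarrow> g (b + j * d) = g b"
      using N unfolding vdW_bound_def by blast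
    have lt: "b + j * d < N" if "j < k" for j
    proof -
      have "j * d \<le> k * d" using that by simp
      then show ?thesis using bd(2) by linarith
    qed
    have "arith_prog (Suc b) d k \<subseteq> {1..N}" using lt by (fastforce simp: arith_prog_def)
    moreover have "monochromatic f (g b) (arith_prog (Suc b) d k)"
      using lt bd(3) by (force simp: monochromatic_def arith_prog_def g_def)
    ultimately show "\<exists>b d q. d > 0 \<and> arith_prog b d k \<subseteq> {1..N} \<and> monochromatic f q (arith_prog b d k)"
      using bd(1) by blast
  qed
  then have "Q (LEAST N. Q N)" by (rule LeastI)
  then show ?thesis using assms(2) unfolding Q_def vdW_def by blast
qed

text \<open>An injection of \<open>S\<close> into \<open>{1..c}\<close> produces an ordinary
  colouring. Since \<open>card S \<le> c\<close> is enough, an upper bound on the number of colours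
  can be used without monotonicity of \<open>vdW\<close> in \<open>c\<close>.\<close>

lemma vdW_colouring:
  assumes "finite S" and "S \<noteq> {}" and "card S \<le> c" and "g \<in> {1..vdW k c} \<rightarrow> S"
  shows "\<exists>b d. d > 0 \<and> arith_prog b d k \<subseteq> {1..vdW k c} \<and> (\<forall>j<k. g (b + j * d) = g b)"
proof -
  have c: "c \<ge> 1" using assms(1-3) by (metis One_nat_def Suc_leI card_gt_0_iff le_trans)
  obtain e where e: "inj_on e S" "e ` S \<subseteq> {1..c}"
    using assms(1,3) card_le_inj[of S "{1..c}"] by auto
  then have "e \<circ> g \<in> {1..vdW k c} \<rightarrow> {1..c}" using assms(4) by fastforce
  then obtain b d q where d: "d > 0" and sub: "arith_prog b d k \<subseteq> {1..vdW k c}"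
    and mono: "monochromatic (e \<circ> g) q (arith_prog b d k)"
    using vdW_property[OF c] by blast
  have mem: "b + j * d \<in> arith_prog b d k" if "j < k" for j
    using that by (auto simp: arith_prog_def)
  have "g (b + j * d) = g b" if j: "j < k" for j
  proof (rule inj_onD[OF e(1)])
    have "b \<in> arith_prog b d k" using mem[of 0] j by simp
    then show "e (g (b + j * d)) = e (g b)" "g (b + j * d) \<in> S" "g b \<in> S"
      using mono mem[OF j] sub assms(4) by (auto simp: monochromatic_def)
  qed
  then show ?thesis using d sub by blast
qed

lemma vdW_pos:
  assumes "k \<ge> 1" and "c \<ge> 1"
  shows "vdW k c \<ge> 1"
proof -
  have "(\<lambda>_. 1) \<in> {1..vdW k c} \<rightarrow> {1..c}" using assms(2) by auto
  from vdW_property[OF assms(2) this] obtain b d where "arith_prog b d k \<subseteq> {1..vdW k c}"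
    by blast
  moreover have "b + 0 * d \<in> arith_prog b d k" using assms(1) unfolding arith_prog_def by fastforce
  ultimately show ?thesis by auto
qed

section \<open>Generalised progressions\<close>

lemma gen_prog_0: "gen_prog a d m 0 = {a}"
  by (auto simp: gen_prog_def)

lemma gen_prog_Suc:
  "gen_prog a d m (Suc n) =
    (\<lambda>(y, t). y + t * d (Suc n)) ` (gen_prog a d m n \<times> {..m (Suc n) - 1})" (is "?L = ?R")
proof
  show "?L \<subseteq> ?R"
  proof
    fix y assume "y \<in> ?L"
    then obtain x where x: "y = a + (\<Sum>j=1..Suc n. x j * d j)" "\<forall>j\<in>{1..Suc n}. x j \<le> m j - 1"
      by (auto simp: gen_prog_def)
    then have "a + (\<Sum>j=1..n. x j * d j) \<in> gen_prog a d m n"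
      unfolding gen_prog_def by auto
    moreover have "x (Suc n) \<in> {..m (Suc n) - 1}" using x(2) by simp
    ultimately show "y \<in> ?R" using x(1)
      by (intro image_eqI[of _ _ "(a + (\<Sum>j=1..n. x j * d j), x (Suc n))"]) auto
  qed
  show "?R \<subseteq> ?L"
  proof clarify
    fix y t assume "y \<in> gen_prog a d m n" and t: "t \<le> m (Suc n) - 1"
    then obtain x where x: "y = a + (\<Sum>j=1..n. x j * d j)" "\<forall>j\<in>{1..n}. x j \<le> m j - 1"
      by (auto simp: gen_prog_def)
    define x' where "x' = x(Suc n := t)"
    have "(\<Sum>j=1..n. x' j * d j) = (\<Sum>j=1..n. x j * d j)"
      by (intro sum.cong) (auto simp: x'_def)
    then have "y + t * d (Suc n) = a + (\<Sum>j=1..Suc n. x' j * d j)"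
      using x(1) by (simp add: x'_def)
    moreover have "\<forall>j\<in>{1..Suc n}. 0 \<le> x' j \<and> x' j \<le> m j - 1"
      using x(2) t by (auto simp: x'_def le_Suc_eq)
    ultimately show "y + t * d (Suc n) \<in> ?L" unfolding gen_prog_def by blast
  qed
qed

lemma gen_prog_translate: "gen_prog (a + s) d m n = (\<lambda>y. y + s) ` gen_prog a d m n"
  unfolding gen_prog_def by (auto simp: image_iff algebra_simps)

text \<open>Entries of \<open>d\<close> outside \<open>{1..n}\<close> are free. This permits
  changing the multipliers at \<open>Suc n\<close> in the induction, and storing the colour at index
  0 later.\<close>

lemma gen_prog_cong:
  assumes "\<And>i. i \<in> {1..n} \<Longrightarrow> d i = d' i"
  shows "gen_prog a d m n = gen_prog a d' m n"
proof -
  have "(\<Sum>j=1..n. x j * d j) = (\<Sum>j=1..n. x j * d' j)" for x :: "nat \<Rightarrow> nat"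
    using assms by (intro sum.cong) auto
  then show ?thesis unfolding gen_prog_def by simp
qed

lemma gen_prog_mono:
  assumes "i \<le> n"
  shows "gen_prog a d m i \<subseteq> gen_prog a d m n"
  using assms
proof (induction n rule: dec_induct)
  case (step n)
  have "gen_prog a d m n \<subseteq> gen_prog a d m (Suc n)"
    by (force simp: gen_prog_Suc)
  then show ?case using step.IH by blast
qed simp

lemma finite_gen_prog: "finite (gen_prog a d m n)"
  by (induction n) (auto simp: gen_prog_0 gen_prog_Suc)

text \<open>Different coefficients may give the same sum, so counting coefficients bounds the size.
  The condition \<open>m i \<ge> 1\<close> ensures that \<open>{..m i - 1}\<close> has
  \<open>m i\<close> elements under truncated subtraction.\<close>

lemma card_gen_prog_le:
  assumes "m 0 = 1" and "\<And>i. i \<ge> 1 \<Longrightarrow> m i \<ge> 1"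
  shows "card (gen_prog a d m n) \<le> (\<Prod>j\<in>{0..n}. m j)"
proof (induction n)
  case 0
  show ?case using assms(1) by (simp add: gen_prog_0)
next
  case (Suc n)
  have "card (gen_prog a d m (Suc n)) \<le> card (gen_prog a d m n \<times> {..m (Suc n) - 1})"
    unfolding gen_prog_Suc by (intro card_image_le) (simp add: finite_gen_prog)
  also have "\<dots> = card (gen_prog a d m n) * m (Suc n)"
    using assms(2)[of "Suc n"] by (simp add: card_cartesian_product)
  also have "\<dots> \<le> (\<Prod>j\<in>{0..Suc n}. m j)" using Suc by simp
  finally show ?case .
qed

section \<open>Monochromatic progressions at a fixed level\<close>

lemma vdW_seq_pos:
  assumes "c \<ge> 1" and "\<And>i. i \<ge> 1 \<Longrightarrow> k i \<ge> 1"
  shows "vdW_seq k c i \<ge> 1"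
proof (cases i)
  case (Suc n)
  have "c ^ (\<Prod>j\<in>{0..n}. vdW_seq k c j) \<ge> 1" using assms(1) by simp
  then show ?thesis using vdW_pos assms(2) Suc by simp
qed simp

text \<open>The induction varies \<open>f\<close> because the hypothesis is applied to a translated
  colouring. The clause \<open>b \<ge> a\<close> later yields a positive base point.\<close>

lemma monochromatic_gen_prog_finite:
  fixes l :: "nat \<Rightarrow> nat"
  assumes "c \<ge> 1" and k: "\<And>i. i \<ge> 1 \<Longrightarrow> k i \<ge> 2"
    and "f \<in> gen_prog a l (vdW_seq k c) n \<rightarrow> {1..c}"
  shows "\<exists>\<alpha> b q. b \<ge> a \<and> q \<in> {1..c} \<and>
    (\<forall>i\<in>{1..n}. 1 \<le> \<alpha> i \<and> \<alpha> i \<le> (vdW_seq k c i - 1) div (k i - 1)) \<and>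
    gen_prog b (\<lambda>i. \<alpha> i * l i) k n \<subseteq> gen_prog a l (vdW_seq k c) n \<and>
    monochromatic f q (gen_prog b (\<lambda>i. \<alpha> i * l i) k n)"
  using assms(3)
proof (induction n arbitrary: f)
  case 0
  then show ?case by (auto simp: gen_prog_0 monochromatic_def)
next
  case (Suc n)
  define W where "W = vdW_seq k c"
  define L where "L = l (Suc n)"
  define P where "P = gen_prog a l W n"
  define C where "C = c ^ (\<Prod>j\<in>{0..n}. W j)"
  have W: "W (Suc n) = vdW (k (Suc n)) C" by (simp add: W_def C_def)
  have step: "y + t * L \<in> gen_prog a l W (Suc n)" if "y \<in> P" "t \<le> W (Suc n) - 1" for y t
    using that by (auto simp: gen_prog_Suc P_def L_def)
  define S where "S = PiE P (\<lambda>_. {1..c})"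
  \<comment> \<open>\<open>g x\<close> is the colour pattern on a translate of \<open>P\<close>. Van
    der Waerden's interval starts at 1 but the coefficients of \<open>L\<close> start at 0, hence
    \<open>x - 1\<close>.\<close>
  define g where "g x = restrict (\<lambda>y. f (y + (x - 1) * L)) P" for x
  have finP: "finite P" by (simp add: P_def finite_gen_prog)
  have "card S = c ^ card P" by (simp add: S_def card_PiE finP)
  also have "card P \<le> (\<Prod>j\<in>{0..n}. W j)" unfolding P_def
  proof (rule card_gen_prog_le)
    show "W 0 = 1" by (simp add: W_def)
    have "k i \<ge> 1" if "i \<ge> 1" for i using k[OF that] by simp
    then show "W i \<ge> 1" for i unfolding W_def by (intro vdW_seq_pos[OF assms(1)])
  qed
  \<comment> \<open>The exponent in \<open>vdW_seq\<close> is made for this estimate: there are at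
    most \<open>C\<close> patterns on \<open>P\<close>.\<close>
  then have "c ^ card P \<le> C" unfolding C_def using assms(1) by (intro power_increasing)
  finally have "card S \<le> C" .
  moreover have "finite S" unfolding S_def using finP by (intro finite_PiE) auto
  moreover have "S \<noteq> {}" using assms(1) by (auto simp: S_def PiE_eq_empty_iff)
  moreover have fr: "f (y + (x - 1) * L) \<in> {1..c}" if "y \<in> P" "x \<in> {1..W (Suc n)}" for x y
  proof -
    have "x - 1 \<le> W (Suc n) - 1" using that(2) by (simp add: diff_le_mono)
    from step[OF that(1) this] show ?thesis using Suc.prems unfolding W_def by (rule funcset_mem[rotated])
  qed
  then have "g \<in> {1..vdW (k (Suc n)) C} \<rightarrow> S"
    unfolding S_def g_def W[symmetric] by auto
  ultimately obtain b' d where d: "d > 0"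
    and sub: "arith_prog b' d (k (Suc n)) \<subseteq> {1..W (Suc n)}"
    and g: "\<And>j. j < k (Suc n) \<Longrightarrow> g (b' + j * d) = g b'"
    using vdW_colouring[of S C g "k (Suc n)"] unfolding W by blast
  have k2: "k (Suc n) \<ge> 2" using k by simp
  have ap: "b' + j * d \<in> {1..W (Suc n)}" if "j < k (Suc n)" for j
    using sub that unfolding arith_prog_def by blast
  have b'1: "b' \<in> {1..W (Suc n)}" using ap[of 0] k2 by simp
  define s where "s = b' - 1"
  have sj: "b' + j * d - 1 = s + j * d" for j using b'1 by (simp add: s_def)
  \<comment> \<open>The \<open>k (Suc n)\<close> translates carry the same pattern, though each may
    still use many colours.\<close>
  have feq: "f (y + (s + j * d) * L) = f (y + s * L)" if "y \<in> P" "j < k (Suc n)" for y j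
    using fun_cong[OF g[OF that(2)], of y] that(1) sj[of j] by (simp add: g_def s_def)
  \<comment> \<open>Recursion into the first translate: a monochromatic progression found there
    recurs, in the same colour, in all the others.\<close>
  have "(\<lambda>y. f (y + s * L)) \<in> gen_prog a l (vdW_seq k c) n \<rightarrow> {1..c}"
    using fr[OF _ b'1] unfolding s_def P_def W_def by blast
  from Suc.IH[OF this] obtain \<alpha> b q where b: "b \<ge> a" and q: "q \<in> {1..c}"
    and \<alpha>: "\<forall>i\<in>{1..n}. 1 \<le> \<alpha> i \<and> \<alpha> i \<le> (W i - 1) div (k i - 1)"
    and subP: "gen_prog b (\<lambda>i. \<alpha> i * l i) k n \<subseteq> P"
    and mono: "monochromatic (\<lambda>y. f (y + s * L)) q (gen_prog b (\<lambda>i. \<alpha> i * l i) k n)"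
    unfolding W_def P_def by blast
  define \<alpha>' where "\<alpha>' = \<alpha>(Suc n := d)"
  \<comment> \<open>The last term of the progression is at most \<open>W (Suc n)\<close> and the
    first at least 1, which bounds \<open>d\<close>; dividing uses
    \<open>k (Suc n) - 1 > 0\<close>.\<close>
  have "b' + (k (Suc n) - 1) * d \<le> W (Suc n)" using ap[of "k (Suc n) - 1"] k2 by simp
  then have "d * (k (Suc n) - 1) \<le> W (Suc n) - 1" using b'1 by (simp add: mult.commute)
  then have "d \<le> (W (Suc n) - 1) div (k (Suc n) - 1)"
    using k2 by (simp add: less_eq_div_iff_mult_less_eq)
  then have \<alpha>': "\<forall>i\<in>{1..Suc n}. 1 \<le> \<alpha>' i \<and> \<alpha>' i \<le> (W i - 1) div (k i - 1)"
    using \<alpha> d by (auto simp: \<alpha>'_def le_Suc_eq)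
  have \<alpha>'_Suc: "\<alpha>' (Suc n) = d" by (simp add: \<alpha>'_def)
  have same: "gen_prog b (\<lambda>i. \<alpha>' i * l i) k n = gen_prog b (\<lambda>i. \<alpha> i * l i) k n"
    by (rule gen_prog_cong) (auto simp: \<alpha>'_def)
  \<comment> \<open>The new difference is \<open>d * L\<close>, so the term with coefficient
    \<open>j\<close> lies in translate number \<open>s + j * d\<close>, one of those coloured
    alike.\<close>
  have mem: "z \<in> gen_prog a l W (Suc n) \<and> f z = q"
    if z: "z \<in> gen_prog (b + s * L) (\<lambda>i. \<alpha>' i * l i) k (Suc n)" for z
  proof -
    obtain y j where y: "y \<in> gen_prog b (\<lambda>i. \<alpha> i * l i) k n" and j: "j \<le> k (Suc n) - 1"
      and "z = y + s * L + j * (d * L)"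
      using z \<alpha>'_Suc by (auto simp: gen_prog_Suc gen_prog_translate same L_def)
    then have zz: "z = y + (s + j * d) * L" by (simp add: algebra_simps)
    have j': "j < k (Suc n)" using j k2 by linarith
    have yP: "y \<in> P" using y subP by blast
    have "s + j * d \<le> W (Suc n) - 1" using ap[OF j'] sj[of j] by auto
    then show ?thesis
      using step[OF yP] feq[OF yP j'] mono y zz by (auto simp: monochromatic_def)
  qed
  show ?case
  proof (intro exI conjI)
    show "a \<le> b + s * L" using b by simp
    show "q \<in> {1..c}" by (rule q)
    show "\<forall>i\<in>{1..Suc n}. 1 \<le> \<alpha>' i \<and> \<alpha>' i \<le> (vdW_seq k c i - 1) div (k i - 1)"
      using \<alpha>' by (simp add: W_def)
    show "gen_prog (b + s * L) (\<lambda>i. \<alpha>' i * l i) k (Suc n) \<subseteq> gen_prog a l (vdW_seq k c) (Suc n)"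
      using mem by (auto simp: W_def)
    show "monochromatic f q (gen_prog (b + s * L) (\<lambda>i. \<alpha>' i * l i) k (Suc n))"
      using mem by (auto simp: monochromatic_def)
  qed
qed

section \<open>Compactness\<close>

text \<open>Koenig's lemma for the tree of prefixes: the bound \<open>B\<close> makes it finitely
  branching, and since \<open>P n\<close> depends only on entries up to \<open>n\<close>, the limit
  of a branch satisfies every \<open>P n\<close>.\<close>

lemma koenig_bounded_sequences:
  fixes P :: "nat \<Rightarrow> (nat \<Rightarrow> nat) \<Rightarrow> bool" and B :: "nat \<Rightarrow> nat"
  assumes ex: "\<And>n. \<exists>\<beta>. P n \<beta>"
    and bounded: "\<And>n \<beta> i. P n \<beta> \<Longrightarrow> i \<le> n \<Longrightarrow> \<beta> i \<le> B i"
    and down: "\<And>m n \<beta>. P n \<beta> \<Longrightarrow> m \<le> n \<Longrightarrow> P m \<beta>"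
    and local: "\<And>n \<beta> \<gamma>. P n \<beta> \<Longrightarrow> (\<And>i. i \<le> n \<Longrightarrow> \<beta> i = \<gamma> i) \<Longrightarrow> P n \<gamma>"
  shows "\<exists>\<gamma>. \<forall>n. P n \<gamma>"
proof -
  \<comment> \<open>Only the first \<open>m\<close> entries of \<alpha> count: they must extend to
    solutions of every level, which is what survives passing to a longer prefix.\<close>
  define Q where "Q m \<alpha> \<longleftrightarrow> (\<forall>n. \<exists>\<beta>. P n \<beta> \<and> (\<forall>i<m. \<beta> i = \<alpha> i))" for m \<alpha>
  have extend: "\<exists>\<alpha>'. Q (Suc m) \<alpha>' \<and> (\<forall>i<m. \<alpha>' i = \<alpha> i)" if Qm: "Q m \<alpha>" for m \<alpha>
  proof -
    have "\<exists>v. Q (Suc m) (\<alpha>(m := v))"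
    proof (rule ccontr)
      assume "\<not> ?thesis"
      then have "\<forall>v. \<exists>n. \<forall>\<beta>. P n \<beta> \<longrightarrow> (\<exists>i<Suc m. \<beta> i \<noteq> (\<alpha>(m := v)) i)"
        unfolding Q_def by blast
      then obtain h where h: "\<And>v \<beta>. P (h v) \<beta> \<Longrightarrow> \<exists>i<Suc m. \<beta> i \<noteq> (\<alpha>(m := v)) i"
        by metis
      \<comment> \<open>\<open>h v\<close> is a level at which the value \<open>v\<close> fails. A
        solution at a level above all of these takes an admissible value at \<open>m\<close>, and by
        \<open>down\<close> it refutes the failure of that value.\<close>
      define n where "n = max m (Max (h ` {..B m}))"
      obtain \<beta> where \<beta>: "P n \<beta>" "\<forall>i<m. \<beta> i = \<alpha> i" using Qm unfolding Q_def by blast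
      have "\<beta> m \<le> B m" using bounded[OF \<beta>(1)] by (simp add: n_def)
      then have "h (\<beta> m) \<le> n" by (simp add: n_def le_max_iff_disj)
      then have "P (h (\<beta> m)) \<beta>" by (rule down[OF \<beta>(1)])
      then show False using h[of "\<beta> m" \<beta>] \<beta>(2) by (auto simp: less_Suc_eq)
    qed
    then obtain v where "Q (Suc m) (\<alpha>(m := v))" ..
    then show ?thesis by (intro exI[of _ "\<alpha>(m := v)"]) auto
  qed
  have "\<exists>\<alpha>. Q 0 \<alpha>" using ex by (auto simp: Q_def)
  then obtain \<alpha> where \<alpha>: "\<And>m. Q m (\<alpha> m)" "\<And>m i. i < m \<Longrightarrow> \<alpha> (Suc m) i = \<alpha> m i"
    using dependent_nat_choice[of Q "\<lambda>m \<alpha> \<alpha>'. \<forall>i<m. \<alpha>' i = \<alpha> i"] extend by blast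
  \<comment> \<open>Entry \<open>i\<close> of the chosen prefixes is fixed from stage
    \<open>Suc i\<close> on, so the diagonal is their limit.\<close>
  define \<gamma> where "\<gamma> i = \<alpha> (Suc i) i" for i
  have agree: "\<alpha> m i = \<gamma> i" if "Suc i \<le> m" for m i
    using that by (induction m rule: dec_induct) (auto simp: \<gamma>_def \<alpha>(2))
  have "P n \<gamma>" for n
  proof -
    obtain \<beta> where "P n \<beta>" "\<forall>i<Suc n. \<beta> i = \<alpha> (Suc n) i" using \<alpha>(1)[of "Suc n"] by (auto simp: Q_def)
    then show ?thesis using agree by (intro local[of n \<beta> \<gamma>]) auto
  qed
  then show ?thesis by blast
qed

section \<open>One sequence of multipliers and one colour for all levels\<close>

theorem theorem2p2:
  fixes a c :: nat and k l :: "nat \<Rightarrow> nat" and A :: "nat set" and f :: "nat \<Rightarrow> nat"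
  assumes "a \<ge> 1" and "c \<ge> 1"
    and "2 \<le> k 1" and "\<And>i. i \<ge> 1 \<Longrightarrow> k i \<le> k (i + 1)"
    and "\<And>i. i \<ge> 1 \<Longrightarrow> l i \<ge> 1"
    and "\<And>i. i \<ge> 2 \<Longrightarrow> l i > (\<Sum>j=1..i-1. (vdW_seq k c j - 1) * l j)"
    and "A = (\<Union>i\<in>{1..}. gen_prog a l (vdW_seq k c) i)"
    and "f \<in> A \<rightarrow> {1..c}"
  shows "\<exists>(b :: nat \<Rightarrow> nat) (d :: nat \<Rightarrow> nat) (\<alpha> :: nat \<Rightarrow> nat).
      (\<forall>i\<ge>1. b i \<ge> 1 \<and> d i \<ge> 1 \<and> d i = \<alpha> i * l i \<and>
         1 \<le> \<alpha> i \<and> \<alpha> i \<le> (vdW_seq k c i - 1) div (k i - 1)) \<and>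
      (\<forall>i\<ge>1. gen_prog (b i) d k i \<subseteq> A) \<and>
      (\<exists>q\<in>{1..c}. \<forall>i\<ge>1. monochromatic f q (gen_prog (b i) d k i))"
proof -
  define W where "W = vdW_seq k c"
  have k: "k i \<ge> 2" if "i \<ge> 1" for i
    using that
  proof (induction i rule: dec_induct)
    case (step i)
    then show ?case using assms(4)[of i] by simp
  qed (use assms(3) in simp)
  have sub: "gen_prog a l W n \<subseteq> A" for n
  proof -
    \<comment> \<open>The union \<open>A\<close> starts at level 1, so passing to
      \<open>Suc n\<close> also covers \<open>n = 0\<close>.\<close>
    have "gen_prog a l W n \<subseteq> gen_prog a l W (Suc n)" by (rule gen_prog_mono) simp
    also have "\<dots> \<subseteq> A" by (auto simp: assms(7) W_def)
    finally show ?thesis .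
  qed
  \<comment> \<open>The unused entry \<open>\<beta> 0\<close> carries the colour, so that one compactness argument fixes both.\<close>
  define P where "P n \<beta> \<longleftrightarrow> \<beta> 0 \<in> {1..c} \<and>
    (\<forall>i\<in>{1..n}. 1 \<le> \<beta> i \<and> \<beta> i \<le> (W i - 1) div (k i - 1)) \<and>
    (\<exists>b\<ge>1. gen_prog b (\<lambda>i. \<beta> i * l i) k n \<subseteq> A \<and>
      monochromatic f (\<beta> 0) (gen_prog b (\<lambda>i. \<beta> i * l i) k n))" for n \<beta>
  have "\<exists>\<gamma>. \<forall>n. P n \<gamma>"
  proof (rule koenig_bounded_sequences[where B = "\<lambda>i. if i = 0 then c else (W i - 1) div (k i - 1)"])
    fix n
    have "f \<in> gen_prog a l (vdW_seq k c) n \<rightarrow> {1..c}" using sub[of n] assms(8) by (auto simp: W_def)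
    from monochromatic_gen_prog_finite[OF assms(2) k this]
    obtain \<alpha> b q where *: "b \<ge> a" "q \<in> {1..c}"
      "\<forall>i\<in>{1..n}. 1 \<le> \<alpha> i \<and> \<alpha> i \<le> (W i - 1) div (k i - 1)"
      "gen_prog b (\<lambda>i. \<alpha> i * l i) k n \<subseteq> gen_prog a l W n"
      "monochromatic f q (gen_prog b (\<lambda>i. \<alpha> i * l i) k n)"
      unfolding W_def by blast
    have "gen_prog b (\<lambda>i. (\<alpha>(0 := q)) i * l i) k n = gen_prog b (\<lambda>i. \<alpha> i * l i) k n"
      by (rule gen_prog_cong) auto
    moreover have "b \<ge> 1" using *(1) assms(1) by simp
    ultimately have "P n (\<alpha>(0 := q))"
      unfolding P_def using *(2-5) sub[of n] by (intro conjI exI[of _ b]) auto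
    then show "\<exists>\<beta>. P n \<beta>" by blast
  next
    fix n \<beta> i assume "P n \<beta>" "i \<le> n"
    then show "\<beta> i \<le> (if i = 0 then c else (W i - 1) div (k i - 1))" by (auto simp: P_def)
  next
    fix m n \<beta> assume "P n \<beta>" "m \<le> n"
    \<comment> \<open>The same base point works, since the lower progression is contained in the
      higher one.\<close>
    then show "P m \<beta>"
      unfolding P_def monochromatic_def
      using gen_prog_mono[OF \<open>m \<le> n\<close>, of _ "\<lambda>i. \<beta> i * l i" k] by fastforce
  next
    fix n and \<beta> \<gamma> :: "nat \<Rightarrow> nat" assume P: "P n \<beta>" and eq: "\<And>i. i \<le> n \<Longrightarrow> \<beta> i = \<gamma> i"
    have "gen_prog b (\<lambda>i. \<beta> i * l i) k n = gen_prog b (\<lambda>i. \<gamma> i * l i) k n" for b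
      using eq by (intro gen_prog_cong) auto
    then show "P n \<gamma>" using P eq unfolding P_def by simp
  qed
  then obtain \<gamma> where \<gamma>: "\<And>n. P n \<gamma>" by blast
  define d where "d i = \<gamma> i * l i" for i
  \<comment> \<open>Base points are quantified inside \<open>P\<close> and may change with the
    level; compactness fixes only the multipliers and the colour.\<close>
  have "\<forall>n. \<exists>b\<ge>1. gen_prog b d k n \<subseteq> A \<and> monochromatic f (\<gamma> 0) (gen_prog b d k n)"
    using \<gamma> unfolding P_def d_def by blast
  then obtain b where b: "\<And>n. b n \<ge> 1" "\<And>n. gen_prog (b n) d k n \<subseteq> A"
    "\<And>n. monochromatic f (\<gamma> 0) (gen_prog (b n) d k n)" by metis
  have \<gamma>i: "1 \<le> \<gamma> i \<and> \<gamma> i \<le> (W i - 1) div (k i - 1)" if "i \<ge> 1" for i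
    using \<gamma>[of i] that by (auto simp: P_def)
  have "d i \<ge> 1" if "i \<ge> 1" for i
    using \<gamma>i[OF that] assms(5)[OF that] by (simp add: d_def)
  moreover have "\<gamma> 0 \<in> {1..c}" using \<gamma>[of 0] by (simp add: P_def)
  ultimately have "(\<forall>i\<ge>1. b i \<ge> 1 \<and> d i \<ge> 1 \<and> d i = \<gamma> i * l i \<and>
         1 \<le> \<gamma> i \<and> \<gamma> i \<le> (vdW_seq k c i - 1) div (k i - 1)) \<and>
      (\<forall>i\<ge>1. gen_prog (b i) d k i \<subseteq> A) \<and>
      (\<exists>q\<in>{1..c}. \<forall>i\<ge>1. monochromatic f q (gen_prog (b i) d k i))"
    using b \<gamma>i unfolding W_def by (intro conjI allI impI bexI[of _ "\<gamma> 0"]) (simp_all add: d_def)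
  then show ?thesis by blast
qed

end
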